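(* Suppose that the following assumptions are satisfied: (1) $X$ is a finite dimensional normed space; (2) $A$ is closed; (3) there exists a globally optimal solution of the problem $(\mathcal{P})$; (4) $\Phi$ is lower semicontinuous on the set $A \times \{ 0 \}$; (5) the function $\langle \lambda, \cdot \rangle$ is continuous at the origin for any $\lambda \in \Lambda$; (6) $\sigma$ has a valley at zero. Then $\mathcal{A}(\mathcal{P})$ coincides with the set of all those $\lambda \in \mathcal{A}_{loc}(\mathcal{P})$ for which the augmented Lagrangian $\mathscr{L}$ is non-degenerate.
   Context: Setting. $X$ is a topological space (here a finite dimensional normed space), $A \subset X$ is a nonempty set, $f \colon X \to \mathbb{R} \cup \{+\infty\}$, and $(\mathcal{P})$ denotes the problem of minimizing $f(x)$ subject to $x \in A$. It is assumed that $\{x \in A \mid f(x) < +\infty\} \ne \emptyset$ and that the optimal value $f^* = \inf_{x \in A} f(x)$ is finite. $P$ is a topological vector space of parameters, $\Lambda$ is a vector space of multipliers, and $\langle \cdot, \cdot \rangle \colon \Lambda \times P \to \mathbb{R}$ is a bilinear coupling function. $\Phi \colon X \times P \to \overline{\mathbb{R}} = \mathbb{R} \cup \{\pm\infty\}$ is a fixed dualizing parameterization function for $f$, i.e. $\Phi(x, 0) = f(x)$ for all $x \in X$. $\sigma \colon P \to [0, +\infty]$ is a fixed augmenting function, i.e. $\sigma(0) = 0$ and $\sigma(p) > 0$ for all $p \in P \setminus \{0\}$. The optimal value function is $v(p) = \inf_{x \in A} \Phi(x, p)$, so $v(0) = f^*$. The augmented Lagrangian is $\mathscr{L}(x, \lambda,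 r) = \inf_{p \in P} ( \Phi(x, p) - \langle \lambda, p \rangle + r \sigma(p) )$ for $x \in X$, $\lambda \in \Lambda$, $r \ge 0$. A multiplier $\lambda \in \Lambda$ is an augmented Lagrange multiplier of $(\mathcal{P})$ if there exists $r \ge 0$ such that $v(p) \ge v(0) + \langle \lambda, p \rangle - r \sigma(p)$ for all $p \in P$. The set of all augmented Lagrange multipliers of $(\mathcal{P})$ is denoted $\mathcal{A}(\mathcal{P})$. Let $x^*$ be a locally optimal solution of $(\mathcal{P})$. A multiplier $\lambda \in \Lambda$ is a (local) augmented Lagrange multiplier at $x^*$ if there exists $r_0 \ge 0$ such that for any $r \ge r_0$ the point $x^*$ is a local minimizer of $\mathscr{L}(\cdot, \lambda, r)$ on $A$, and $\mathscr{L}(x^*, \lambda, r) = f(x^* )$. The set of all such $\lambda$ is denoted $\mathcal{A}(x^* )$. Finally, $\mathcal{A}_{loc}(\mathcal{P}) = \bigcap \mathcal{A}(x^* )$, where the intersection is over all globally optimal solutions $x^*$ of $(\mathcal{P})$. $\sigma$ has a valley at zero if for any neighbourhood $U \subset P$ of zero there exists $\delta > 0$ such that $\sigma(p) \ge \delta$ for all $p \in P \setminus U$. For a fixed $\lambda^* \in \Lambda$ (and $X$ a normed space), $\mathscr{L}(x, \lambda, r)$ is non-degenerate for $\lambda = \lambda^*$ if there exist $r_0 \ge 0$ and $K > 0$ such that for any $r \ge r_0$ the function $\mathscr{L}(\cdot, \lambda^*, r)$ attains a global minimum on $A$, and there exists $x_r \in \operatorname{arg\,min}_{x \in A} \mathscr{L}(x,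 \lambda^*, r)$ such that $\| x_r \| \le K$.
   Formalization: In the definition of non-degeneracy, attaining a global minimum on A is taken to mean that the minimal value of the augmented Lagrangian is finite; if the value −∞ were allowed, the claim would be false. *)

theory Defs
  imports "HOL-Analysis.Analysis"
begin

text \<open>
  Real topological vector spaces. As in Bourbaki, the Hausdorff property is not required.
\<close>

class real_topological_vector = real_vector + topological_ab_group_add +
  assumes tendsto_scaleR_nhds:
    "LIM z (nhds (c :: real) \<times>\<^sub>F nhds a). fst z *\<^sub>R snd z :> nhds (c *\<^sub>R a)"

instance real_normed_vector < real_topological_vector
proof
  fix c :: real and a :: "'a :: real_normed_vector"
  show "LIM z (nhds c \<times>\<^sub>F nhds a). fst z *\<^sub>R snd z :> nhds (c *\<^sub>R a)"
    by (intro tendsto_scaleR filterlim_fst filterlim_snd)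
qed

definition local_minimizer_on :: "('x::topological_space \<Rightarrow> ereal) \<Rightarrow> 'x set \<Rightarrow> 'x \<Rightarrow> bool" where
  "local_minimizer_on g A x \<longleftrightarrow>
     x \<in> A \<and> (\<exists>U. open U \<and> x \<in> U \<and> (\<forall>y \<in> A \<inter> U. g x \<le> g y))"

definition lsc_at :: "('z::topological_space \<Rightarrow> ereal) \<Rightarrow> 'z \<Rightarrow> bool" where
  "lsc_at g z \<longleftrightarrow> (\<forall>c. c < g z \<longrightarrow> eventually (\<lambda>w. c < g w) (nhds z))"

definition optimal_value :: "'x set \<Rightarrow> ('x \<times> 'p \<Rightarrow> ereal) \<Rightarrow> 'p \<Rightarrow> ereal" where
  "optimal_value A \<Phi> p = (INF x\<in>A. \<Phi> (x, p))"

text \<open>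
  The arithmetic of \<^typ>\<open>ereal\<close> satisfies \<open>-\<infinity> + \<infinity> = \<infinity>\<close>, the usual convention in
  minimization, and \<open>0 * \<infinity> = 0\<close>. Hence points \<open>p\<close> with \<open>\<sigma> p = \<infinity>\<close> do not contribute to the
  infimum when \<open>r > 0\<close>, whatever the value of \<open>\<Phi> (x, p)\<close>.
\<close>

definition aug_lagrangian ::
  "('x \<times> 'p \<Rightarrow> ereal) \<Rightarrow> ('l \<Rightarrow> 'p \<Rightarrow> real) \<Rightarrow> ('p \<Rightarrow> ereal) \<Rightarrow> 'x \<Rightarrow> 'l \<Rightarrow> real \<Rightarrow> ereal" where
  "aug_lagrangian \<Phi> coupling \<sigma> x l r =
     (INF p. \<Phi> (x, p) - ereal (coupling l p) + ereal r * \<sigma> p)"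

definition aug_multipliers ::
  "'x set \<Rightarrow> ('x \<times> 'p::zero \<Rightarrow> ereal) \<Rightarrow> ('l \<Rightarrow> 'p \<Rightarrow> real) \<Rightarrow> ('p \<Rightarrow> ereal) \<Rightarrow> 'l set" where
  "aug_multipliers A \<Phi> coupling \<sigma> =
     {l. \<exists>r\<ge>0. \<forall>p. optimal_value A \<Phi> p
            \<ge> optimal_value A \<Phi> 0 + ereal (coupling l p) - ereal r * \<sigma> p}"

definition aug_multipliers_at ::
  "'x::topological_space set \<Rightarrow> ('x \<Rightarrow> ereal) \<Rightarrow> ('x \<times> 'p \<Rightarrow> ereal) \<Rightarrow> ('l \<Rightarrow> 'p \<Rightarrow> real)
     \<Rightarrow> ('p \<Rightarrow> ereal) \<Rightarrow> 'x \<Rightarrow> 'l set" where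
  "aug_multipliers_at A f \<Phi> coupling \<sigma> x =
     {l. \<exists>r0\<ge>0. \<forall>r\<ge>r0.
        local_minimizer_on (\<lambda>y. aug_lagrangian \<Phi> coupling \<sigma> y l r) A x \<and>
        aug_lagrangian \<Phi> coupling \<sigma> x l r = f x}"

definition local_aug_multipliers ::
  "'x::topological_space set \<Rightarrow> ('x \<Rightarrow> ereal) \<Rightarrow> ('x \<times> 'p \<Rightarrow> ereal) \<Rightarrow> ('l \<Rightarrow> 'p \<Rightarrow> real)
     \<Rightarrow> ('p \<Rightarrow> ereal) \<Rightarrow> 'l set" where
  "local_aug_multipliers A f \<Phi> coupling \<sigma> =
     (\<Inter>x \<in> {x. is_arg_min f (\<lambda>y. y \<in> A) x}. aug_multipliers_at A f \<Phi> coupling \<sigma> x)"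

definition valley_at_zero :: "('p::{topological_space, zero} \<Rightarrow> ereal) \<Rightarrow> bool" where
  "valley_at_zero \<sigma> \<longleftrightarrow>
     (\<forall>U. eventually (\<lambda>p. p \<in> U) (nhds 0) \<longrightarrow> (\<exists>\<delta>>0. \<forall>p \<in> - U. \<sigma> p \<ge> ereal \<delta>))"

text \<open>
  Attaining a global minimum means that the minimum is a real number; a point at which the
  function equals \<open>-\<infinity>\<close> does not count.
\<close>

definition attains_minimum_on :: "('x \<Rightarrow> ereal) \<Rightarrow> 'x set \<Rightarrow> bool" where
  "attains_minimum_on g A \<longleftrightarrow> (\<exists>x. is_arg_min g (\<lambda>y. y \<in> A) x \<and> \<bar>g x\<bar> \<noteq> \<infinity>)"

definition non_degenerate ::
  "'x::real_normed_vector set \<Rightarrow> ('x \<times> 'p \<Rightarrow> ereal) \<Rightarrow> ('l \<Rightarrow> 'p \<Rightarrow> real) \<Rightarrow> ('p \<Rightarrow> ereal)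
     \<Rightarrow> 'l \<Rightarrow> bool" where
  "non_degenerate A \<Phi> coupling \<sigma> l \<longleftrightarrow>
     (\<exists>r0\<ge>0. \<exists>K>0. \<forall>r\<ge>r0.
        attains_minimum_on (\<lambda>x. aug_lagrangian \<Phi> coupling \<sigma> x l r) A \<and>
        (\<exists>x. is_arg_min (\<lambda>x. aug_lagrangian \<Phi> coupling \<sigma> x l r) (\<lambda>x. x \<in> A) x \<and> norm x \<le> K))"

end

theory Submission
  imports Defs
begin

text \<open>
  A multiplier \<open>l\<close> belongs to \<open>\<A>(\<P>)\<close> iff, for some \<open>r\<close>, the optimal value is a lower bound of
  \<open>\<L>(\<cdot>, l, r)\<close> on \<open>A\<close>; since \<open>\<L> \<le> f\<close>, optimal solutions then minimize the Lagrangian for all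
  larger \<open>r\<close>. Conversely, non-degeneracy yields minimizers \<open>x\<^sub>n\<close> of \<open>\<L>(\<cdot>, l, r\<^sub>0 + n)\<close> in a bounded
  set; a cluster point \<open>z\<close> of them is optimal by lower semicontinuity and the valley of \<open>\<sigma>\<close>. As
  \<open>l\<close> is a local multiplier at \<open>z\<close>, the minimum over \<open>A\<close> equals \<open>f(z)\<close> as soon as \<open>x\<^sub>n\<close> enters the
  neighbourhood of local optimality.
\<close>

section \<open>Compactness of bounded sequences in finite dimension\<close>

text \<open>Induction on the spanning set: split off the coefficient along the new vector
  \<open>b\<close>. It stays bounded because \<open>b\<close> has positive distance from
  \<open>span S\<close>, so subsequences are extracted first for the coefficients, then by induction
  for the remainders.\<close>

lemma bounded_seq_in_finite_span_subseq:
  fixes x :: "nat \<Rightarrow> 'x::real_normed_vector"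
  assumes "finite S" and "\<And>n. x n \<in> span S" and "bounded (range x)"
  shows "\<exists>l\<in>span S. \<exists>r. strict_mono r \<and> (x \<circ> r) \<longlonglongrightarrow> l"
  using assms
proof (induction S arbitrary: x rule: finite_induct)
  case empty
  then have "x n = 0" for n by simp
  then have "x = (\<lambda>n. 0)" by auto
  then show ?case
    using strict_mono_id by (auto simp: o_def intro!: exI[of _ id])
next
  case (insert b S)
  show ?case
  proof (cases "b \<in> span S")
    case True
    then have "span (insert b S) = span S" by (rule span_redundant)
    with insert show ?thesis by metis
  next
    case False
    \<comment> \<open>A convergent sequence is bounded, so the induction hypothesis puts a
      subsequential limit, hence the limit itself, into \<open>span S\<close>.\<close>
    have "closed (span S)"
      unfolding closed_sequential_limits
    proof (intro allI impI, elim conjE)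
      fix y l assume y: "\<forall>n. y n \<in> span S" "y \<longlonglongrightarrow> l"
      then have "bounded (range y)"
        by (auto intro: convergent_imp_bounded)
      with insert.IH[of y] y obtain l' r where
        "l' \<in> span S" "strict_mono r" "(y \<circ> r) \<longlonglongrightarrow> l'" by blast
      moreover from y \<open>strict_mono r\<close> have "(y \<circ> r) \<longlonglongrightarrow> l"
        by (blast intro: LIMSEQ_subseq_LIMSEQ)
      ultimately show "l \<in> span S" using LIMSEQ_unique by metis
    qed
    then obtain d where "d > 0" "ball b d \<subseteq> - span S"
      using False unfolding closed_def open_contains_ball by blast
    then have d: "d > 0" "\<And>y. y \<in> span S \<Longrightarrow> d \<le> dist b y"
      by (auto simp: subset_iff not_less[symmetric])
    have "\<exists>t. x n - t *\<^sub>R b \<in> span S" for n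
      using insert.prems(1)[of n] by (auto simp: span_insert)
    then obtain t where t: "\<And>n. x n - t n *\<^sub>R b \<in> span S" by metis
    obtain K where K: "\<And>n. norm (x n) \<le> K"
      using insert.prems(2) by (auto simp: bounded_iff)
    have t_bound: "\<bar>t n\<bar> \<le> K / d" for n
    proof (cases "t n = 0")
      case True
      have "0 \<le> K" using norm_ge_zero[of "x n"] K[of n] by linarith
      with True d show ?thesis by simp
    next
      case False
      define y where "y = x n - t n *\<^sub>R b"
      \<comment> \<open>Dividing \<open>x n\<close> by \<open>t n\<close> gives \<open>b\<close>
        minus a vector of \<open>span S\<close>, which has norm at least \<open>d\<close>.\<close>
      have "(- inverse (t n)) *\<^sub>R y \<in> span S"
        using t[of n] unfolding y_def by (rule span_scale)
      then have "d \<le> norm (b + inverse (t n) *\<^sub>R y)"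
        using d(2)[of "(- inverse (t n)) *\<^sub>R y"] by (simp add: dist_norm)
      then have "\<bar>t n\<bar> * d \<le> norm (t n *\<^sub>R (b + inverse (t n) *\<^sub>R y))"
        by (simp add: mult_left_mono)
      also have "t n *\<^sub>R (b + inverse (t n) *\<^sub>R y) = x n"
        using False by (simp add: y_def scaleR_add_right)
      finally show ?thesis using K[of n] d(1) by (simp add: field_simps)
    qed
    then have "bounded (range t)" by (auto simp: bounded_iff)
    then obtain s r where r: "strict_mono r" "(t \<circ> r) \<longlonglongrightarrow> s"
      using bounded_imp_convergent_subsequence by blast
    define y where "y n = x (r n) - t (r n) *\<^sub>R b" for n
    have "norm (y n) \<le> K + K / d * norm b" for n
      unfolding y_def
      using norm_triangle_ineq4[of "x (r n)" "t (r n) *\<^sub>R b"] K[of "r n"]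
        mult_right_mono[OF t_bound[of "r n"] norm_ge_zero[of b]] by simp
    then have "bounded (range y)" by (auto simp: bounded_iff)
    then obtain l q where q: "l \<in> span S" "strict_mono q" "(y \<circ> q) \<longlonglongrightarrow> l"
      using insert.IH[of y] t unfolding y_def by blast
    have "(t \<circ> r \<circ> q) \<longlonglongrightarrow> s"
      using LIMSEQ_subseq_LIMSEQ[OF r(2) q(2)] .
    then have "(\<lambda>n. (t \<circ> r \<circ> q) n *\<^sub>R b + (y \<circ> q) n) \<longlonglongrightarrow> s *\<^sub>R b + l"
      by (intro tendsto_intros q(3))
    then have "(x \<circ> (r \<circ> q)) \<longlonglongrightarrow> s *\<^sub>R b + l"
      by (simp add: y_def o_def)
    moreover have "s *\<^sub>R b + l \<in> span (insert b S)"
      using q(1) by (auto simp: span_insert intro!: exI[of _ s])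
    moreover have "strict_mono (r \<circ> q)"
      using r(1) q(2) by (rule strict_mono_o)
    ultimately show ?thesis by blast
  qed
qed

lemma finite_dimensional_bounded_seq_subseq:
  fixes x :: "nat \<Rightarrow> 'x::real_normed_vector"
  assumes "\<exists>B :: 'x set. finite_dimensional_vector_space scaleR B"
    and "bounded (range x)"
  obtains l r where "strict_mono r" "(x \<circ> r) \<longlonglongrightarrow> l"
proof -
  from assms(1) obtain B :: "'x set" where "finite_dimensional_vector_space scaleR B" ..
  then interpret fd: finite_dimensional_vector_space scaleR B .
  have "span B = UNIV"
    using fd.span_Basis by (simp add: span_raw_def)
  with bounded_seq_in_finite_span_subseq[OF fd.finite_Basis _ assms(2)] that
  show thesis by auto
qed

section \<open>Monotonicity and bounds of the augmented Lagrangian\<close>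

text \<open>For infinite \<open>s\<close> both sides hold, even at \<open>a = -\<infinity>\<close>,
  since \<open>-\<infinity> + \<infinity> = \<infinity>\<close>; otherwise finite terms move
  across.\<close>

lemma ereal_le_diff_add_iff:
  fixes a s :: ereal
  assumes "0 \<le> s"
  shows "ereal m \<le> a - ereal c + s \<longleftrightarrow> ereal m + ereal c - s \<le> a"
  using assms by (cases a; cases s) auto

lemma aug_lagrangian_mono:
  assumes "\<And>p. 0 \<le> \<sigma> p" and "r \<le> r'"
  shows "aug_lagrangian \<Phi> coupling \<sigma> x l r \<le> aug_lagrangian \<Phi> coupling \<sigma> x l r'"
  unfolding aug_lagrangian_def
  using assms by (intro INF_mono' add_left_mono ereal_mult_right_mono) auto

lemma aug_lagrangian_le_zero_param:
  assumes "\<sigma> 0 = 0" and "coupling l 0 = 0"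
  shows "aug_lagrangian \<Phi> coupling \<sigma> x l r \<le> \<Phi> (x, 0)"
  unfolding aug_lagrangian_def
  by (rule INF_lower2[of 0]) (use assms in \<open>auto simp: zero_ereal_def[symmetric]\<close>)

text \<open>Unfolding the infima leaves the same inequalities in \<open>x\<close> and
  \<open>p\<close> on both sides, with the quantifiers interchanged.\<close>

lemma aug_multipliers_iff:
  fixes A :: "'x set" and \<Phi> :: "'x \<times> 'p::zero \<Rightarrow> ereal"
  assumes "\<And>p. 0 \<le> \<sigma> p" and "optimal_value A \<Phi> 0 = ereal m"
  shows "l \<in> aug_multipliers A \<Phi> coupling \<sigma> \<longleftrightarrow>
    (\<exists>r\<ge>0. \<forall>x\<in>A. ereal m \<le> aug_lagrangian \<Phi> coupling \<sigma> x l r)"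
proof -
  have "(\<forall>p. optimal_value A \<Phi> p \<ge> ereal m + ereal (coupling l p) - ereal r * \<sigma> p) \<longleftrightarrow>
    (\<forall>x\<in>A. ereal m \<le> aug_lagrangian \<Phi> coupling \<sigma> x l r)" if "0 \<le> r" for r
  proof -
    have "0 \<le> ereal r * \<sigma> p" for p using assms(1) that by simp
    then show ?thesis
      unfolding optimal_value_def aug_lagrangian_def le_INF_iff
      by (simp only: ereal_le_diff_add_iff) blast
  qed
  then show ?thesis
    unfolding aug_multipliers_def assms(2) by blast
qed

text \<open>
  Near \<open>(x, 0)\<close> the bound comes from lower semicontinuity of \<open>\<Phi>\<close>; away from \<open>p = 0\<close> the valley
  of \<open>\<sigma>\<close> makes the excess penalty \<open>(r - s) \<sigma> p\<close> over the finite lower bound at \<open>s\<close> arbitrarily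
  large.
\<close>

lemma aug_lagrangian_eventually_ge:
  fixes A :: "'x::topological_space set" and \<Phi> :: "'x \<times> 'p::{topological_space, zero} \<Rightarrow> ereal"
  assumes "\<And>p. 0 \<le> \<sigma> p" and "lsc_at \<Phi> (x, 0)"
    and "(coupling l \<longlongrightarrow> 0) (nhds 0)" and "valley_at_zero \<sigma>"
    and "\<And>y. y \<in> A \<Longrightarrow> ereal m \<le> aug_lagrangian \<Phi> coupling \<sigma> y l s"
    and "ereal c < \<Phi> (x, 0)"
  shows "\<exists>r0. \<exists>U. open U \<and> x \<in> U \<and>
    (\<forall>r\<ge>r0. \<forall>y\<in>A \<inter> U. ereal c \<le> aug_lagrangian \<Phi> coupling \<sigma> y l r)"
proof -
  \<comment> \<open>The gap \<open>c' - c\<close> will absorb the coupling term for parameters near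
    zero.\<close>
  obtain c' where c': "ereal c < ereal c'" "ereal c' < \<Phi> (x, 0)"
    using ereal_dense2[OF assms(6)] by blast
  have "eventually (\<lambda>w. ereal c' < \<Phi> w) (nhds (x, 0))"
    using assms(2) c'(2) by (simp add: lsc_at_def)
  then obtain S where S: "open S" "(x, 0) \<in> S" "\<And>w. w \<in> S \<Longrightarrow> ereal c' < \<Phi> w"
    unfolding eventually_nhds by blast
  from S(1,2) obtain U V where "open U" "open V" "(x, 0) \<in> U \<times> V" "U \<times> V \<subseteq> S"
    by (rule open_prod_elim)
  then have UV: "open U" "x \<in> U" "eventually (\<lambda>p. p \<in> V) (nhds 0)"
    "\<And>y p. y \<in> U \<Longrightarrow> p \<in> V \<Longrightarrow> ereal c' < \<Phi> (y, p)"
    using S(3) by (auto intro: eventually_nhds_in_open)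
  define W where "W = {p \<in> V. coupling l p < c' - c}"
  have "eventually (\<lambda>p. coupling l p < c' - c) (nhds 0)"
    using assms(3) c'(1) by (intro order_tendstoD(2)) auto
  with UV(3) have "eventually (\<lambda>p. p \<in> W) (nhds 0)"
    unfolding W_def by (simp add: eventually_conj_iff)
  then obtain \<delta> where \<delta>: "\<delta> > 0" "\<And>p. p \<notin> W \<Longrightarrow> ereal \<delta> \<le> \<sigma> p"
    using assms(4) unfolding valley_at_zero_def by blast
  \<comment> \<open>The bound 1 keeps \<open>r\<close> positive, so that an infinite
    \<open>\<sigma> p\<close> gives an infinite penalty; the other two give
    \<open>r - s \<ge> 0\<close> and \<open>(r - s) * \<delta> \<ge> c - m\<close>.\<close>
  define r0 where "r0 = max 1 (max s (s + (c - m) / \<delta>))"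
  have "ereal c \<le> \<Phi> (y, p) - ereal (coupling l p) + ereal r * \<sigma> p"
    if r: "r0 \<le> r" and y: "y \<in> A" "y \<in> U" for r y p
  proof (cases "p \<in> W")
    case True
    have "0 \<le> ereal r * \<sigma> p" using r assms(1) by (simp add: r0_def)
    moreover have "ereal c' < \<Phi> (y, p)" "coupling l p < c' - c"
      using True UV(4) y by (auto simp: W_def)
    ultimately show ?thesis
      by (cases "\<Phi> (y, p)"; cases "ereal r * \<sigma> p") auto
  next
    case False
    have "s \<le> r" "s + (c - m) / \<delta> \<le> r" using r by (auto simp: r0_def)
    then have "c - m \<le> (r - s) * \<delta>" using \<delta>(1) by (simp add: field_simps)
    have m_le: "ereal m \<le> \<Phi> (y, p) - ereal (coupling l p) + ereal s * \<sigma> p"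
      using assms(5)[OF y(1)] unfolding aug_lagrangian_def le_INF_iff by blast
    show ?thesis
    proof (cases "\<sigma> p")
      \<comment> \<open>Split \<open>r * e = s * e + (r - s) * e\<close>: with the first part the
        value is at least \<open>m\<close>, and the second adds at least
        \<open>c - m\<close>.\<close>
      case (real e)
      then have "\<delta> \<le> e" using \<delta>(2)[OF False] by simp
      then have "c - m \<le> (r - s) * e"
        using \<open>c - m \<le> (r - s) * \<delta>\<close> mult_left_mono[of \<delta> e "r - s"] \<open>s \<le> r\<close> by linarith
      with real m_le show ?thesis
        by (cases "\<Phi> (y, p)") (auto simp: algebra_simps)
    next
      case PInf
      with r show ?thesis by (simp add: r0_def)
    next
      case MInf
      with assms(1)[of p] show ?thesis by simp
    qed
  qed
  then show ?thesis
    using UV(1,2) unfolding aug_lagrangian_def le_INF_iff by blast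
qed

section \<open>Global multipliers from local ones and non-degeneracy\<close>

theorem theorem2:
  fixes A :: "'x::real_normed_vector set"
    and f :: "'x \<Rightarrow> ereal"
    and \<Phi> :: "'x \<times> 'p::real_topological_vector \<Rightarrow> ereal"
    and coupling :: "'l::real_vector \<Rightarrow> 'p \<Rightarrow> real"
    and \<sigma> :: "'p \<Rightarrow> ereal"
  assumes "A \<noteq> {}"
    and "\<And>x. f x \<noteq> -\<infinity>"
    and "{x \<in> A. f x < \<infinity>} \<noteq> {}"
    and "\<bar>INF x\<in>A. f x\<bar> \<noteq> \<infinity>"
    and "bilinear coupling"
    and "\<And>x. \<Phi> (x, 0) = f x"
    and "\<sigma> 0 = 0"
    and "\<And>p. p \<noteq> 0 \<Longrightarrow> \<sigma> p > 0"
    and "\<exists>B :: 'x set. finite_dimensional_vector_space scaleR B"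
    and "closed A"
    and "\<exists>x. is_arg_min f (\<lambda>y. y \<in> A) x"
    and "\<And>z. z \<in> A \<times> {0} \<Longrightarrow> lsc_at \<Phi> z"
    and "\<And>l. (coupling l \<longlongrightarrow> coupling l 0) (nhds 0)"
    and "valley_at_zero \<sigma>"
  shows "aug_multipliers A \<Phi> coupling \<sigma> =
    {l \<in> local_aug_multipliers A f \<Phi> coupling \<sigma>. non_degenerate A \<Phi> coupling \<sigma> l}"
proof -
  obtain xo where xo: "is_arg_min f (\<lambda>y. y \<in> A) xo" using assms(11) by blast
  then have xo_le: "xo \<in> A" "\<And>y. y \<in> A \<Longrightarrow> f xo \<le> f y"
    by (auto simp: is_arg_min_linorder)
  have f_argmin: "(INF x\<in>A. f x) = f x" if "is_arg_min f (\<lambda>y. y \<in> A) x" for x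
    using that by (intro antisym INF_lower INF_greatest) (auto simp: is_arg_min_linorder)
  obtain m where m: "(INF x\<in>A. f x) = ereal m" using assms(4) by auto
  have opt: "optimal_value A \<Phi> 0 = ereal m"
    by (simp add: optimal_value_def assms(6) m)
  have \<sigma>: "0 \<le> \<sigma> p" for p using assms(7,8) by (metis order.refl order.strict_implies_order)
  have c0: "coupling l 0 = 0" for l using assms(5) by (rule bilinear_rzero)
  let ?L = "\<lambda>r x l. aug_lagrangian \<Phi> coupling \<sigma> x l r"
  have L_le: "?L r x l \<le> f x" for r x l
    using aug_lagrangian_le_zero_param[where \<Phi>=\<Phi> and \<sigma>=\<sigma> and coupling=coupling, OF assms(7) c0] by (simp add: assms(6))
  show ?thesis
  proof (intro set_eqI iffI)
    fix l assume "l \<in> aug_multipliers A \<Phi> coupling \<sigma>"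
    then obtain r0 where r0: "r0 \<ge> 0" "\<And>x. x \<in> A \<Longrightarrow> ereal m \<le> ?L r0 x l"
      unfolding aug_multipliers_iff[where \<sigma>=\<sigma>, OF \<sigma> opt] by blast
    have ge: "ereal m \<le> ?L r x l" if "r0 \<le> r" "x \<in> A" for r x
      using r0(2)[OF that(2)] aug_lagrangian_mono[where \<sigma>=\<sigma>, OF \<sigma> that(1)] by (rule order_trans)
    \<comment> \<open>Optimal solutions are squeezed between the lower bound \<open>m\<close> and
      \<open>f x = m\<close>. They minimize the Lagrangian on all of \<open>A\<close>, so the
      neighbourhood below can be \<open>UNIV\<close>.\<close>
    have L_opt: "?L r x l = ereal m" if "r0 \<le> r" "is_arg_min f (\<lambda>y. y \<in> A) x" for r x
      using that ge[of r x] L_le[of x l r] f_argmin[OF that(2)] m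
      by (auto simp: is_arg_min_linorder intro: antisym)
    have "l \<in> aug_multipliers_at A f \<Phi> coupling \<sigma> x" if x: "is_arg_min f (\<lambda>y. y \<in> A) x" for x
      unfolding aug_multipliers_at_def local_minimizer_on_def
      using r0(1) L_opt[OF _ x] ge f_argmin[OF x] m x
      by (auto simp: is_arg_min_linorder intro!: exI[of _ r0] exI[of _ UNIV])
    \<comment> \<open>One minimizer \<open>xo\<close> serves every \<open>r \<ge> r0\<close>; the
      bound \<open>norm xo + 1\<close> is positive even for \<open>xo = 0\<close>.\<close>
    moreover have "is_arg_min (\<lambda>x. ?L r x l) (\<lambda>y. y \<in> A) xo" "\<bar>?L r xo l\<bar> \<noteq> \<infinity>"
      if "r0 \<le> r" for r
      using L_opt[OF that xo] ge[OF that] xo_le(1) by (auto simp: is_arg_min_linorder)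
    then have "non_degenerate A \<Phi> coupling \<sigma> l"
      unfolding non_degenerate_def attains_minimum_on_def
      using r0(1)
      by (intro exI[of _ r0] exI[of _ "norm xo + 1"] conjI allI impI exI[of _ xo])
        (auto simp: add_nonneg_pos)
    ultimately show
      "l \<in> {l \<in> local_aug_multipliers A f \<Phi> coupling \<sigma>. non_degenerate A \<Phi> coupling \<sigma> l}"
      unfolding local_aug_multipliers_def by blast
  next
    fix l
    assume "l \<in> {l \<in> local_aug_multipliers A f \<Phi> coupling \<sigma>. non_degenerate A \<Phi> coupling \<sigma> l}"
    then have loc: "\<And>x. is_arg_min f (\<lambda>y. y \<in> A) x \<Longrightarrow> l \<in> aug_multipliers_at A f \<Phi> coupling \<sigma> x"
      and "non_degenerate A \<Phi> coupling \<sigma> l"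
      by (auto simp: local_aug_multipliers_def)
    then obtain r0 K where r0: "r0 \<ge> 0"
      and att: "attains_minimum_on (\<lambda>x. ?L r0 x l) A"
      and "\<And>r. r \<ge> r0 \<Longrightarrow> \<exists>x. is_arg_min (\<lambda>x. ?L r x l) (\<lambda>x. x \<in> A) x \<and> norm x \<le> K"
      unfolding non_degenerate_def by blast
    then have "\<exists>x. is_arg_min (\<lambda>x. ?L (r0 + real n) x l) (\<lambda>x. x \<in> A) x \<and> norm x \<le> K" for n
      by simp
    then obtain x where x: "\<And>n. is_arg_min (\<lambda>x. ?L (r0 + real n) x l) (\<lambda>x. x \<in> A) (x n)"
      and "\<And>n. norm (x n) \<le> K" by metis
    then have "bounded (range x)" by (auto simp: bounded_iff)
    then obtain z q where q: "strict_mono q" "(x \<circ> q) \<longlonglongrightarrow> z"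
      using finite_dimensional_bounded_seq_subseq[OF assms(9)] by blast
    have xA: "x n \<in> A" and x_le: "\<And>y. y \<in> A \<Longrightarrow> ?L (r0 + real n) (x n) l \<le> ?L (r0 + real n) y l" for n
      using x[of n] by (auto simp: is_arg_min_linorder)
    have zA: "z \<in> A"
      using assms(10) q(2) xA unfolding closed_sequential_limits by (metis comp_apply)
    \<comment> \<open>Every neighbourhood of the cluster point contains minimizers for arbitrarily
      large penalties.\<close>
    have large: "\<exists>n. x n \<in> U \<and> r \<le> r0 + real n" if "open U" "z \<in> U" for U r
    proof -
      have "eventually (\<lambda>n. x (q n) \<in> U) sequentially"
        using topological_tendstoD[OF q(2) that] by simp
      moreover have "eventually (\<lambda>n. r \<le> r0 + real (q n)) sequentially"
        using filterlim_compose[OF filterlim_real_sequentially filterlim_subseq[OF q(1)]]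
        by (simp add: filterlim_at_top eventually_mono[of "\<lambda>n. r - r0 \<le> real (q n)"])
      ultimately have "eventually (\<lambda>n. x (q n) \<in> U \<and> r \<le> r0 + real (q n)) sequentially"
        by (rule eventually_conj)
      then show ?thesis using eventually_happens'[OF sequentially_bot] by blast
    qed
    have "f z \<le> ereal m"
    proof (rule ccontr)
      assume "\<not> f z \<le> ereal m"
      then obtain c where c: "ereal m < ereal c" "ereal c < f z"
        using ereal_dense2[of "ereal m" "f z"] by (metis not_le)
      \<comment> \<open>The minimum attained at \<open>r0\<close> is real, which supplies the finite
        lower bound to be compared with the penalty.\<close>
      obtain u where u: "\<And>y. y \<in> A \<Longrightarrow> ereal u \<le> ?L r0 y l"
        using att unfolding attains_minimum_on_def is_arg_min_linorder
        by (metis ereal_real')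
      have "(coupling l \<longlongrightarrow> 0) (nhds 0)" using assms(13)[of l] by (simp add: c0)
      with zA c(2) obtain r1 U where U: "open U" "z \<in> U"
        "\<And>r y. r \<ge> r1 \<Longrightarrow> y \<in> A \<Longrightarrow> y \<in> U \<Longrightarrow> ereal c \<le> ?L r y l"
        using aug_lagrangian_eventually_ge[where \<sigma>=\<sigma> and A=A and \<Phi>=\<Phi> and x=z and c=c and l=l
            and coupling=coupling, OF \<sigma> assms(12) _ assms(14) u]
        by (auto simp: assms(6))
      obtain n where "x n \<in> U" "r1 \<le> r0 + real n" using large[OF U(1,2)] by blast
      then have "ereal c \<le> ?L (r0 + real n) (x n) l" using U(3) xA by blast
      also have "\<dots> \<le> ?L (r0 + real n) xo l" using x_le xo_le(1) by blast
      also have "\<dots> \<le> ereal m" using L_le[of xo l] f_argmin[OF xo] m by simp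
      finally show False using c(1) by simp
    qed
    with zA have z: "is_arg_min f (\<lambda>y. y \<in> A) z"
      using INF_lower[of _ A f] m by (auto simp: is_arg_min_linorder intro: order_trans)
    \<comment> \<open>The neighbourhood may depend on the penalty, so it is fixed at
      \<open>r1\<close>; monotonicity in the penalty then lifts the bound at \<open>x n\<close> to
      \<open>r0 + real n\<close>, where \<open>x n\<close> is a global minimizer.\<close>
    from loc[OF this] obtain r1 U where U: "open U" "z \<in> U"
      "\<And>y. y \<in> A \<Longrightarrow> y \<in> U \<Longrightarrow> ?L r1 z l \<le> ?L r1 y l" "?L r1 z l = f z"
      unfolding aug_multipliers_at_def local_minimizer_on_def by blast
    obtain n where n: "x n \<in> U" "r1 \<le> r0 + real n" using large[OF U(1,2)] by blast
    have "ereal m \<le> ?L (r0 + real n) y l" if "y \<in> A" for y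
    proof -
      have "ereal m = ?L r1 z l" using U(4) f_argmin[OF z] m by simp
      also have "\<dots> \<le> ?L r1 (x n) l" using U(3) xA n(1) by blast
      also have "\<dots> \<le> ?L (r0 + real n) (x n) l"
        using aug_lagrangian_mono[where \<sigma>=\<sigma>, OF \<sigma> n(2)] .
      also have "\<dots> \<le> ?L (r0 + real n) y l" using x_le that .
      finally show ?thesis .
    qed
    then show "l \<in> aug_multipliers A \<Phi> coupling \<sigma>"
      unfolding aug_multipliers_iff[where \<sigma>=\<sigma>, OF \<sigma> opt]
      using r0 by (intro exI[of _ "r0 + real n"]) auto
  qed
qed

end
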